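(* Let $m\ge 1$ be an integer and let $\mathbf t=\{t_0,t_1,\ldots,t_{m-1}\}$ be an asymmetric set of $m$ distinct points in $(-1,0)\cup(0,1)$. For $1\le j\le m-1$ let $X_j(t)\in\mathbb R^{m}$ be the column vector with entries $$U_{2m-2}(t),U_{2m-4}(t),\ldots,U_{2j}(t),\;U_{2m-1}(t),U_{2m-3}(t),\ldots,U_{2m-2j+1}(t),$$ let $X_m(t)\in\mathbb R^m$ be the column vector with entries $U_{2m-1}(t),U_{2m-3}(t),\ldots,U_3(t),U_1(t)$, and for $1\le j\le m$ let $\Xi_j(\mathbf t)=[X_j(t_0),\ldots,X_j(t_{m-1})]$, an $m\times m$ matrix. Suppose that $\Xi_1(\mathbf t),\Xi_2(\mathbf t),\ldots,\Xi_m(\mathbf t)$ are all nonsingular. Then every polynomial $P\in\Pi_{2m-1}^2$ is uniquely determined by the set of its Radon projections $$\mathcal R_{\phi_{j,m}}(P;t_k),\qquad 0\le j\le 2m,\quad 0\le k\le m-1,\qquad \phi_{j,m}=\frac{2j\pi}{2m+1};$$ that is, if $P,Q\in\Pi_{2m-1}^2$ satisfy $\mathcal R_{\phi_{j,m}}(P;t_k)=\mathcal R_{\phi_{j,m}}(Q;t_k)$ for all $0\le j\le 2m$ and $0\le k\le m-1$, then $P=Q$.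
   Context: $\Pi_n^2$ is the space of real polynomials in two variables of total degree at most $n$. The Radon projection of a function $f$ on the closed unit disk in direction $\theta$ with parameter $t\in[-1,1]$ is $$\mathcal R_\theta(f;t)=\int_{-\sqrt{1-t^2}}^{\sqrt{1-t^2}} f(t\cos\theta-s\sin\theta,\;t\sin\theta+s\cos\theta)\,ds .$$ $U_k$ is the Chebyshev polynomial of the second kind, $U_k(\cos\theta)=\sin((k+1)\theta)/\sin\theta$. A finite set of points in $(-1,0)\cup(0,1)$ is asymmetric if $t$ and $-t$ do not both belong to it. *)

theory Defs
  imports
    "HOL-Analysis.Henstock_Kurzweil_Integration"
    "HOL-Computational_Algebra.Polynomial"
    "Jordan_Normal_Form.Matrix"
begin

text \<open>A real polynomial in two variables \<open>x\<close>, \<open>y\<close> is an element of \<open>\<real>[x][y]\<close>, represented by the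
  type \<^typ>\<open>real poly poly\<close>; the coefficient of \<open>x ^ i * y ^ j\<close> in \<open>P\<close> is \<open>coeff (coeff P j) i\<close>.\<close>

definition eval2 :: "real poly poly \<Rightarrow> real \<times> real \<Rightarrow> real" where
  "eval2 P = (\<lambda>(x, y). poly (poly P [:y:]) x)"

definition Pi2 :: "nat \<Rightarrow> real poly poly set" where
  "Pi2 n = {P. \<forall>i j. coeff (coeff P j) i \<noteq> 0 \<longrightarrow> i + j \<le> n}"

lemma eval2_altdef:
  "eval2 P (x, y) = (\<Sum>j\<le>degree P. \<Sum>i\<le>degree (coeff P j). coeff (coeff P j) i * x ^ i * y ^ j)"
proof -
  have "poly (poly P [:y:]) x = (\<Sum>j\<le>degree P. poly (coeff P j) x * y ^ j)"
    by (simp add: poly_altdef[of P] poly_sum poly_power)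
  also have "\<dots> = (\<Sum>j\<le>degree P. \<Sum>i\<le>degree (coeff P j). coeff (coeff P j) i * x ^ i * y ^ j)"
    by (simp add: poly_altdef sum_distrib_right)
  finally show ?thesis by (simp add: eval2_def)
qed

definition radon :: "real \<Rightarrow> (real \<times> real \<Rightarrow> real) \<Rightarrow> real \<Rightarrow> real" where
  "radon \<theta> f t =
     integral {- sqrt (1 - t\<^sup>2) .. sqrt (1 - t\<^sup>2)}
       (\<lambda>s. f (t * cos \<theta> - s * sin \<theta>, t * sin \<theta> + s * cos \<theta>))"

text \<open>Existence and uniqueness of the polynomial described here are proved in \<open>cheb_U_cos\<close> and
  \<open>cheb_U_unique\<close>.\<close>

definition cheb_U :: "nat \<Rightarrow> real poly" where
  "cheb_U k = (THE p. \<forall>\<theta>. sin \<theta> \<noteq> 0 \<longrightarrow> poly p (cos \<theta>) = sin (real (k + 1) * \<theta>) / sin \<theta>)"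

lemma cheb_U_exists:
  "\<exists>p :: real poly. \<forall>\<theta>. sin \<theta> \<noteq> 0 \<longrightarrow> poly p (cos \<theta>) = sin (real (k + 1) * \<theta>) / sin \<theta>"
proof (induction k rule: less_induct)
  case (less k)
  consider "k = 0" | "k = 1" | l where "k = Suc (Suc l)"
    by (metis One_nat_def not0_implies_Suc)
  then show ?case
  proof cases
    case 1
    then show ?thesis by (intro exI[of _ 1]) simp
  next
    case 2
    then show ?thesis by (intro exI[of _ "[:0, 2:]"]) (simp add: sin_double)
  next
    case (3 l)
    have "l < k" "Suc l < k" and k: "k = l + 2" using 3 by simp_all
    from less.IH[OF this(1)] obtain p :: "real poly" where
      p: "\<forall>\<theta>. sin \<theta> \<noteq> 0 \<longrightarrow> poly p (cos \<theta>) = sin (real (l + 1) * \<theta>) / sin \<theta>" ..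
    from less.IH[OF \<open>Suc l < k\<close>] obtain q :: "real poly" where
      q: "\<forall>\<theta>. sin \<theta> \<noteq> 0 \<longrightarrow> poly q (cos \<theta>) = sin (real (Suc l + 1) * \<theta>) / sin \<theta>" ..
    have "poly ([:0, 2:] * q - p) (cos \<theta>) = sin (real (k + 1) * \<theta>) / sin \<theta>"
      if "sin \<theta> \<noteq> 0" for \<theta> :: real
    proof -
      define a where "a = real (Suc l + 1) * \<theta>"
      have a1: "real (k + 1) * \<theta> = a + \<theta>" and a2: "real (l + 1) * \<theta> = a - \<theta>"
        by (simp_all add: a_def k algebra_simps)
      have pv: "poly p (cos \<theta>) = sin (a - \<theta>) / sin \<theta>"
        using p that unfolding a2[symmetric] by blast
      have qv: "poly q (cos \<theta>) = sin a / sin \<theta>"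
        using q that unfolding a_def by blast
      have "poly ([:0, 2:] * q - p) (cos \<theta>) = (2 * cos \<theta> * sin a - sin (a - \<theta>)) / sin \<theta>"
        by (simp add: pv qv diff_divide_distrib)
      also have "2 * cos \<theta> * sin a - sin (a - \<theta>) = sin (a + \<theta>)"
        by (simp add: sin_add sin_diff)
      finally show ?thesis unfolding a1 .
    qed
    then show ?thesis by (intro exI[of _ "[:0, 2:] * q - p"] allI impI)
  qed
qed

lemma cheb_U_poly_eqI:
  fixes p q :: "real poly"
  assumes "\<And>\<theta>. sin \<theta> \<noteq> 0 \<Longrightarrow> poly p (cos \<theta>) = poly q (cos \<theta>)"
  shows "p = q"
proof (rule ccontr)
  assume "p \<noteq> q"
  then have "finite {x. poly (p - q) x = 0}" by (intro poly_roots_finite) auto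
  moreover have "{-1<..<1} \<subseteq> {x. poly (p - q) x = 0}"
  proof
    fix x :: real assume "x \<in> {-1<..<1}"
    then have x: "cos (arccos x) = x" "sin (arccos x) \<noteq> 0"
      using sin_arccos_nonzero[of x] by auto
    from assms[OF x(2)] show "x \<in> {x. poly (p - q) x = 0}" by (simp add: x(1))
  qed
  ultimately have "finite {-1<..<1 :: real}" by (rule rev_finite_subset)
  then show False by (simp add: infinite_Ioo)
qed

lemma cheb_U_cos:
  assumes "sin \<theta> \<noteq> 0"
  shows "poly (cheb_U k) (cos \<theta>) = sin (real (k + 1) * \<theta>) / sin \<theta>"
proof -
  let ?R = "\<lambda>p :: real poly. \<forall>\<theta>. sin \<theta> \<noteq> 0 \<longrightarrow> poly p (cos \<theta>) = sin (real (k + 1) * \<theta>) / sin \<theta>"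
  have "\<exists>!p. ?R p"
  proof (rule ex_ex1I)
    show "\<exists>p. ?R p" by (rule cheb_U_exists)
  next
    fix p q assume pq: "?R p" "?R q"
    show "p = q"
    proof (rule cheb_U_poly_eqI)
      fix \<theta> :: real assume "sin \<theta> \<noteq> 0"
      then have "poly p (cos \<theta>) = sin (real (k + 1) * \<theta>) / sin \<theta>"
        "poly q (cos \<theta>) = sin (real (k + 1) * \<theta>) / sin \<theta>"
        using pq by blast+
      then show "poly p (cos \<theta>) = poly q (cos \<theta>)" by (rule trans[OF _ sym])
    qed
  qed
  then have "?R (cheb_U k)" unfolding cheb_U_def by (rule theI')
  with assms show ?thesis by blast
qed

lemma cheb_U_unique:
  assumes "\<And>\<theta>. sin \<theta> \<noteq> 0 \<Longrightarrow> poly p (cos \<theta>) = sin (real (k + 1) * \<theta>) / sin \<theta>"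
  shows "p = cheb_U k"
proof (rule cheb_U_poly_eqI)
  fix \<theta> :: real assume "sin \<theta> \<noteq> 0"
  then show "poly p (cos \<theta>) = poly (cheb_U k) (cos \<theta>)"
    by (rule trans[OF assms cheb_U_cos[symmetric]]) fact
qed

definition asymmetric :: "real set \<Rightarrow> bool" where
  "asymmetric T \<longleftrightarrow> finite T \<and> T \<subseteq> {-1<..<0} \<union> {0<..<1} \<and> (\<forall>t. \<not> (t \<in> T \<and> - t \<in> T))"

text \<open>The degrees \<open>2m-2, 2m-4, \<dots>, 2j\<close> (that is, \<open>m - j\<close> of them) followed by the \<open>j\<close> degrees
  \<open>2m-1, 2m-3, \<dots>, 2m-2j+1\<close>.  For \<open>j = m\<close> the first block is empty and the second one is
  \<open>2m-1, 2m-3, \<dots>, 1\<close>, so that \<open>X_m\<close> needs no separate definition.\<close>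

definition X_degrees :: "nat \<Rightarrow> nat \<Rightarrow> nat list" where
  "X_degrees m j = map (\<lambda>i. 2 * m - 2 - 2 * i) [0..<m - j] @ map (\<lambda>i. 2 * m - 1 - 2 * i) [0..<j]"

definition X_vec :: "nat \<Rightarrow> nat \<Rightarrow> real \<Rightarrow> real vec" where
  "X_vec m j t = vec_of_list (map (\<lambda>k. poly (cheb_U k) t) (X_degrees m j))"

definition Xi_mat :: "nat \<Rightarrow> nat \<Rightarrow> (nat \<Rightarrow> real) \<Rightarrow> real mat" where
  "Xi_mat m j t = mat_of_cols m (map (\<lambda>k. X_vec m j (t k)) [0..<m])"

lemma X_degrees_last: "X_degrees m m = map (\<lambda>i. 2 * m - 1 - 2 * i) [0..<m]"
  by (simp only: X_degrees_def diff_self_eq_0 upt_rec[of 0 0] less_irrefl if_False list.map append_Nil)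

lemma X_vec_carrier:
  assumes "j \<le> m"
  shows "X_vec m j x \<in> carrier_vec m"
proof -
  have "length (X_degrees m j) = m"
    unfolding X_degrees_def length_append length_map length_upt using assms by linarith
  then show ?thesis
    unfolding X_vec_def by (intro carrier_vecI) (simp only: dim_vec_of_list length_map)
qed

lemma Xi_mat_carrier: "Xi_mat m j t \<in> carrier_mat m m"
  using mat_of_cols_carrier(1)[of m "map (\<lambda>k. X_vec m j (t k)) [0..<m]"]
  unfolding Xi_mat_def length_map length_upt diff_zero .

lemma Xi_mat_col:
  assumes "j \<le> m" "k < m"
  shows "col (Xi_mat m j t) k = X_vec m j (t k)"
proof -
  let ?c = "map (\<lambda>k. X_vec m j (t k)) [0..<m]"
  have k: "k < length ?c" and nth: "?c ! k = X_vec m j (t k)" using assms(2) by simp_all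
  have "?c ! k \<in> carrier_vec m" unfolding nth by (rule X_vec_carrier[OF assms(1)])
  from col_mat_of_cols[OF k this] show ?thesis unfolding nth Xi_mat_def .
qed

end

theory Submission
  imports Defs
begin

text \<open>Write \<open>z = x + \<i> y\<close>. The Radon projection of \<open>z ^ a * cnj z ^ b\<close> in direction \<open>\<theta>\<close> is
  \<open>cis ((a - b) \<theta>) sqrt (1 - t\<^sup>2)\<close> times a combination of the \<open>U\<^sub>k(t)\<close> with
  \<open>k = a + b, a + b - 2, \<dots>, \<bar>a - b\<bar>\<close>, in which the coefficient of \<open>U\<^sub>k\<close> for \<open>k = a + b\<close> is nonzero.
  Orthogonality of characters on the \<open>2m + 1\<close> equally spaced directions separates the frequencies
  \<open>a - b\<close> modulo \<open>2m + 1\<close>. At most two frequencies of absolute value \<open>\<le> 2m - 1\<close> lie in a nonzero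
  class, and then they have opposite parity; hence in each such class the degrees \<open>a + b\<close> are distinct
  and occur in some \<open>X\<^sub>j\<close>, while in the zero class they are \<open>0, 2, \<dots>, 2m - 2\<close>. Nonsingularity of
  \<open>\<Xi>\<^sub>j\<close>, respectively asymmetry of the nodes, makes the coefficients of all \<open>U\<^sub>k\<close> vanish, and
  triangularity in \<open>a + b\<close> then makes the polynomial itself vanish.\<close>

subsection \<open>Polynomials in the complex coordinates\<close>

text \<open>Working with functions lets sums and products be formed pointwise. The sum runs over a
  full square of exponents, so that the order of summation can be exchanged freely; the vanishing
  condition carries the bound on the total degree.\<close>

definition zz_poly :: "nat \<Rightarrow> (complex \<Rightarrow> complex) \<Rightarrow> bool" where
  "zz_poly n f \<longleftrightarrow> (\<exists>p. (\<forall>a b. n < a + b \<longrightarrow> p a b = 0) \<and>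
     (\<forall>z. f z = (\<Sum>a\<le>n. \<Sum>b\<le>n. p a b * (z ^ a * cnj z ^ b))))"

lemma zz_poly_const: "zz_poly 0 (\<lambda>z. c)"
  unfolding zz_poly_def by (rule exI[of _ "\<lambda>a b. if a + b = 0 then c else 0"]) simp

lemma zz_poly_add:
  assumes "zz_poly n f" "zz_poly n g"
  shows "zz_poly n (\<lambda>z. f z + g z)"
proof -
  from assms obtain p q where
    "\<forall>a b. n < a + b \<longrightarrow> p a b = 0" "\<forall>z. f z = (\<Sum>a\<le>n. \<Sum>b\<le>n. p a b * (z ^ a * cnj z ^ b))"
    "\<forall>a b. n < a + b \<longrightarrow> q a b = 0" "\<forall>z. g z = (\<Sum>a\<le>n. \<Sum>b\<le>n. q a b * (z ^ a * cnj z ^ b))"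
    unfolding zz_poly_def by auto
  then show ?thesis
    unfolding zz_poly_def
    by (intro exI[of _ "\<lambda>a b. p a b + q a b"]) (simp add: distrib_right sum.distrib)
qed

lemma zz_poly_cmult:
  assumes "zz_poly n f"
  shows "zz_poly n (\<lambda>z. c * f z)"
proof -
  from assms obtain p where
    "\<forall>a b. n < a + b \<longrightarrow> p a b = 0" "\<forall>z. f z = (\<Sum>a\<le>n. \<Sum>b\<le>n. p a b * (z ^ a * cnj z ^ b))"
    unfolding zz_poly_def by auto
  then show ?thesis
    unfolding zz_poly_def
    by (intro exI[of _ "\<lambda>a b. c * p a b"]) (simp add: sum_distrib_left mult.assoc)
qed

lemma zz_poly_Suc:
  assumes "zz_poly n f"
  shows "zz_poly (Suc n) f"
proof -
  from assms obtain p where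
    "\<forall>a b. n < a + b \<longrightarrow> p a b = 0" "\<forall>z. f z = (\<Sum>a\<le>n. \<Sum>b\<le>n. p a b * (z ^ a * cnj z ^ b))"
    unfolding zz_poly_def by auto
  then show ?thesis
    unfolding zz_poly_def by (intro exI[of _ p]) simp
qed

lemma zz_poly_mono:
  assumes "zz_poly n f" "n \<le> n'"
  shows "zz_poly n' f"
  using assms(2,1) by (induction rule: dec_induct) (auto intro: zz_poly_Suc)

lemma zz_poly_mult_z:
  assumes "zz_poly n f"
  shows "zz_poly (Suc n) (\<lambda>z. z * f z)"
proof -
  from assms obtain p where
    p: "\<forall>a b. n < a + b \<longrightarrow> p a b = 0" "\<forall>z. f z = (\<Sum>a\<le>n. \<Sum>b\<le>n. p a b * (z ^ a * cnj z ^ b))"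
    unfolding zz_poly_def by auto
  show ?thesis
    unfolding zz_poly_def
  proof (intro exI[of _ "\<lambda>a b. case a of 0 \<Rightarrow> 0 | Suc a' \<Rightarrow> p a' b"] conjI allI impI)
    fix a b assume "Suc n < a + b"
    then show "(case a of 0 \<Rightarrow> 0 | Suc a' \<Rightarrow> p a' b) = 0"
      using p(1) by (cases a) auto
  next
    fix z
    show "z * f z = (\<Sum>a\<le>Suc n. \<Sum>b\<le>Suc n.
      (case a of 0 \<Rightarrow> 0 | Suc a' \<Rightarrow> p a' b) * (z ^ a * cnj z ^ b))"
      \<comment> \<open>The shift removes the zero term \<open>a = 0\<close>; the surplus terms with
        \<open>b = Suc n\<close> vanish because their total degree exceeds \<open>n\<close>.\<close>
      using p(1) by (subst sum.atMost_Suc_shift) (simp add: p(2)[rule_format] sum_distrib_left ac_simps)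
  qed
qed

text \<open>Conjugating the argument exchanges the two exponents. This reduces multiplication by
  \<open>cnj z\<close> to multiplication by \<open>z\<close>.\<close>

lemma zz_poly_cnj_arg:
  assumes "zz_poly n f"
  shows "zz_poly n (\<lambda>z. f (cnj z))"
proof -
  from assms obtain p where
    p: "\<forall>a b. n < a + b \<longrightarrow> p a b = 0" "\<forall>z. f z = (\<Sum>a\<le>n. \<Sum>b\<le>n. p a b * (z ^ a * cnj z ^ b))"
    unfolding zz_poly_def by auto
  show ?thesis
    unfolding zz_poly_def
  proof (intro exI[of _ "\<lambda>a b. p b a"] conjI allI impI)
    fix a b assume "n < a + b"
    then show "p b a = 0" using p(1) by (simp add: add.commute)
  next
    fix z
    show "f (cnj z) = (\<Sum>a\<le>n. \<Sum>b\<le>n. p b a * (z ^ a * cnj z ^ b))"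
      unfolding p(2)[rule_format] by (subst sum.swap) (simp add: ac_simps)
  qed
qed

lemma zz_poly_mult_cnj:
  assumes "zz_poly n f"
  shows "zz_poly (Suc n) (\<lambda>z. cnj z * f z)"
  using zz_poly_cnj_arg[OF zz_poly_mult_z[OF zz_poly_cnj_arg[OF assms]]] by simp

lemma zz_poly_mult_Re:
  assumes "zz_poly n f"
  shows "zz_poly (Suc n) (\<lambda>z. of_real (Re z) * f z)"
proof -
  have "zz_poly (Suc n) (\<lambda>z. 1/2 * (z * f z + cnj z * f z))"
    by (intro zz_poly_cmult zz_poly_add zz_poly_mult_z zz_poly_mult_cnj assms)
  moreover have "1/2 * (z * f z + cnj z * f z) = of_real (Re z) * f z" for z
    by (simp add: complex_eq_iff field_simps)
  ultimately show ?thesis by simp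
qed

lemma zz_poly_mult_Im:
  assumes "zz_poly n f"
  shows "zz_poly (Suc n) (\<lambda>z. of_real (Im z) * f z)"
proof -
  have "zz_poly (Suc n) (\<lambda>z. - \<i>/2 * (z * f z + (-1) * (cnj z * f z)))"
    by (intro zz_poly_cmult zz_poly_add zz_poly_mult_z zz_poly_mult_cnj assms)
  moreover have "- \<i>/2 * (z * f z + (-1) * (cnj z * f z)) = of_real (Im z) * f z" for z
    by (simp add: complex_eq_iff field_simps)
  ultimately show ?thesis by simp
qed

lemma zz_poly_monomial: "zz_poly (i + j) (\<lambda>z. of_real (Re z ^ i * Im z ^ j))"
proof (induction i)
  case 0
  show ?case
  proof (induction j)
    case 0
    show ?case using zz_poly_const[of 1] by simp
  next
    case (Suc j)
    from zz_poly_mult_Im[OF Suc] show ?case by (simp add: ac_simps)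
  qed
next
  case (Suc i)
  from zz_poly_mult_Re[OF Suc] show ?case by (simp add: ac_simps)
qed

lemma zz_poly_sum:
  assumes "finite I" "\<And>i. i \<in> I \<Longrightarrow> zz_poly n (f i)"
  shows "zz_poly n (\<lambda>z. \<Sum>i\<in>I. f i z)"
  using assms
proof (induction rule: finite_induct)
  case empty
  show ?case using zz_poly_mono[OF zz_poly_const[of 0], of n] by simp
qed (simp add: zz_poly_add)

lemma zz_poly_eval2:
  assumes "P \<in> Pi2 n"
  shows "zz_poly n (\<lambda>z. of_real (eval2 P (Re z, Im z)))"
proof -
  have "zz_poly n (\<lambda>z. \<Sum>j\<le>degree P. \<Sum>i\<le>degree (coeff P j).
      of_real (coeff (coeff P j) i) * of_real (Re z ^ i * Im z ^ j))"
  proof (intro zz_poly_sum)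
    fix i j
    show "zz_poly n (\<lambda>z. of_real (coeff (coeff P j) i) * of_real (Re z ^ i * Im z ^ j))"
    proof (cases "coeff (coeff P j) i = 0")
      case True
      then show ?thesis using zz_poly_mono[OF zz_poly_const[of 0], of n] by simp
    next
      case False
      with assms have "i + j \<le> n" unfolding Pi2_def by blast
      then show ?thesis by (intro zz_poly_cmult zz_poly_mono[OF zz_poly_monomial])
    qed
  qed simp_all
  then show ?thesis unfolding eval2_altdef by (simp add: mult.assoc)
qed

text \<open>For fixed \<open>y\<close> the polynomial in \<open>x\<close> has every real as a root,
  so it is zero. Hence \<open>P\<close>, as a polynomial over the domain of polynomials in
  \<open>x\<close>, has the infinitely many roots \<open>[:y:]\<close>.\<close>

lemma eval2_eq_0_imp:
  assumes "\<And>x y. eval2 P (x, y) = 0"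
  shows "P = 0"
proof -
  have z: "poly P [:y:] = 0" for y
    using assms unfolding eval2_def by (intro poly_all_0_iff_0[THEN iffD1]) auto
  show ?thesis
  proof (rule ccontr)
    assume "P \<noteq> 0"
    then have "finite {q. poly P q = 0}" by (rule poly_roots_finite)
    moreover have "range (\<lambda>y. [:y:]) \<subseteq> {q. poly P q = 0}" using z by auto
    ultimately have "finite (range (\<lambda>y :: real. [:y:]))" by (rule rev_finite_subset)
    then have "finite (UNIV :: real set)" by (rule finite_imageD) (auto intro: injI)
    then show False by (simp add: infinite_UNIV_char_0)
  qed
qed

subsection \<open>Radon projections\<close>

text \<open>The coefficients solve the recursion \<open>radon_poly_rec\<close>, which comes from integrating
  \<open>z ^ a * cnj z ^ b\<close> by parts along a chord: the boundary term is a multiple of \<open>U\<^sub>k\<close> for \<open>k = a - b\<close>, and the remaining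
  integral has \<open>a + 1\<close> and \<open>b - 1\<close> in place of \<open>a\<close> and \<open>b\<close>.\<close>

definition radon_coeff :: "nat \<Rightarrow> nat \<Rightarrow> nat \<Rightarrow> real" where
  "radon_coeff a b r = 2 * fact a * fact b / (fact (a + b + 1 - r) * fact r)"

text \<open>By \<open>has_integral_zz\<close> this is the integral of
  \<open>z ^ a * cnj z ^ b\<close> over the chord \<open>Re z = t\<close>, divided by half the
  length of the chord.\<close>

definition radon_poly :: "nat \<Rightarrow> nat \<Rightarrow> real \<Rightarrow> real" where
  "radon_poly a b t = (\<Sum>r\<le>min a b. radon_coeff a b r * poly (cheb_U (a + b - 2 * r)) t)"

lemma radon_poly_commute: "radon_poly a b t = radon_poly b a t"
  by (simp add: radon_poly_def radon_coeff_def ac_simps)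

text \<open>For each \<open>r\<close> the two coefficients have the constant ratio
  \<open>(b + 1) / (a + 1)\<close>. Since \<open>b < a\<close>, the left side has exactly one
  further term, \<open>r = Suc b\<close>, which is the isolated multiple of a Chebyshev
  polynomial.\<close>

lemma radon_poly_rec:
  assumes "b < a"
  shows "radon_poly a (Suc b) t = 2 / real (a + 1) * poly (cheb_U (a - Suc b)) t +
    real (b + 1) / real (a + 1) * radon_poly (Suc a) b t"
proof -
  have "radon_coeff a (Suc b) r = real (b + 1) / real (a + 1) * radon_coeff (Suc a) b r" for r
    unfolding radon_coeff_def fact_Suc by (simp add: divide_simps del: fact_Suc)
  moreover have "radon_coeff a (Suc b) (Suc b) = 2 / real (a + 1)"
    using fact_Suc[of a, where ?'a = real]
    by (simp add: radon_coeff_def divide_simps del: fact_Suc)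
  moreover have "min a (Suc b) = Suc b" "min (Suc a) b = b" "a + Suc b - 2 * Suc b = a - Suc b"
    using assms by auto
  ultimately show ?thesis
    unfolding radon_poly_def by (simp add: sum_distrib_left mult.assoc)
qed

lemma sqrt_cheb_U:
  assumes "\<bar>t\<bar> < 1"
  shows "sqrt (1 - t\<^sup>2) * poly (cheb_U k) t = sin (real (k + 1) * arccos t)"
proof -
  have t: "cos (arccos t) = t" "sin (arccos t) = sqrt (1 - t\<^sup>2)"
    using assms by (auto simp: sin_arccos)
  have "1 - t\<^sup>2 \<noteq> 0" using assms by (auto simp: power2_eq_1_iff)
  then have "sin (arccos t) \<noteq> 0" unfolding t by simp
  from cheb_U_cos[OF this, of k] this show ?thesis unfolding t by (simp add: field_simps)
qed

text \<open>Replacing \<open>t\<close> by \<open>- t\<close> replaces the angle by its supplement,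
  which preserves the sine of an odd multiple. Thus every node yields two roots of an even
  combination.\<close>

lemma cheb_U_uminus_even:
  assumes "\<bar>t\<bar> < 1" "even k"
  shows "poly (cheb_U k) (- t) = poly (cheb_U k) t"
proof -
  have "sin (real (k + 1) * (pi - arccos t)) = sin (real (k + 1) * pi - real (k + 1) * arccos t)"
    by (simp add: algebra_simps)
  also have "\<dots> = sin (real (k + 1) * arccos t)"
    using assms(2) unfolding sin_diff cos_npi sin_npi by simp
  finally have "sqrt (1 - t\<^sup>2) * poly (cheb_U k) (- t) = sqrt (1 - t\<^sup>2) * poly (cheb_U k) t"
    using sqrt_cheb_U[of "- t" k] sqrt_cheb_U[of t k] assms(1) by (simp add: arccos_minus)
  moreover have "1 - t\<^sup>2 \<noteq> 0" using assms by (auto simp: power2_eq_1_iff)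
  ultimately show ?thesis by simp
qed

text \<open>Induction on \<open>b\<close> for all \<open>a\<close> at once: integration by parts
  trades one factor \<open>cnj z\<close> for a factor \<open>z\<close>. The condition
  \<open>b \<le> a\<close> keeps the index \<open>a - b\<close> of the boundary term meaningful and
  survives the trade.\<close>

lemma has_integral_zz_aux:
  assumes "\<bar>t\<bar> < 1" "b \<le> a"
  shows "((\<lambda>s. Complex t s ^ a * cnj (Complex t s) ^ b) has_integral
    of_real (sqrt (1 - t\<^sup>2) * radon_poly a b t)) {- sqrt (1 - t\<^sup>2) .. sqrt (1 - t\<^sup>2)}"
  using assms(2)
proof (induction b arbitrary: a)
  define w where "w = sqrt (1 - t\<^sup>2)"
  have w: "0 \<le> w" unfolding w_def using assms(1) by (simp add: abs_square_le_1)
  have cis: "Complex t w = cis (arccos t)" "Complex t (- w) = cis (- arccos t)"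
    using assms(1) by (auto simp: complex_eq_iff w_def sin_arccos)
  \<comment> \<open>The product rule applied to \<open>?F\<close> gives the integrand and the traded
    monomial. For \<open>b = 0\<close> the factor \<open>of_nat b\<close> makes the truncated
    exponent \<open>b - 1\<close> harmless.\<close>
  have ftc: "((\<lambda>s. Complex t s ^ a * cnj (Complex t s) ^ b -
       of_nat b / of_nat (a + 1) * (Complex t s ^ Suc a * cnj (Complex t s) ^ (b - 1)))
       has_integral of_real (2 / real (a + 1) * (w * poly (cheb_U (a - b)) t))) {-w..w}"
    if "b \<le> a" for a b
  proof -
    let ?F = "\<lambda>s. Complex t s ^ Suc a * cnj (Complex t s) ^ b / (\<i> * of_nat (a + 1))"
    have "((\<lambda>s. Complex t s ^ a * cnj (Complex t s) ^ b -
       of_nat b / of_nat (a + 1) * (Complex t s ^ Suc a * cnj (Complex t s) ^ (b - 1)))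
       has_integral ?F w - ?F (- w)) {-w..w}"
    proof (rule fundamental_theorem_of_calculus)
      fix s assume "s \<in> {-w..w}"
      have C: "Complex t s = of_real t + \<i> * of_real s" "cnj (Complex t s) = of_real t - \<i> * of_real s" for s
        by (simp_all add: complex_eq_iff)
      \<comment> \<open>Conjugation is not complex differentiable, so the chord parameter is made
        complex: \<open>cnj (Complex t s)\<close> extends to \<open>of_real t - \<i> * z\<close>,
        and the derivative is restricted to real \<open>z\<close> afterwards.\<close>
      have "((\<lambda>z. (of_real t + \<i> * z) ^ Suc a * (of_real t - \<i> * z) ^ b / (\<i> * of_nat (a + 1)))
        has_field_derivative (of_real t + \<i> * z) ^ a * (of_real t - \<i> * z) ^ b -
       of_nat b / of_nat (a + 1) * ((of_real t + \<i> * z) ^ Suc a * (of_real t - \<i> * z) ^ (b - 1))) (at z)"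
        for z
      proof -
        define K where "K = complex_of_nat (a + 1)"
        define u v where "u = of_real t + \<i> * z" and "v = of_real t - \<i> * z"
        have "K \<noteq> 0" unfolding K_def by (metis of_nat_neq_0 Suc_eq_plus1)
        have "((\<lambda>z. (of_real t + \<i> * z) ^ Suc a) has_field_derivative K * (\<i> * u ^ a)) (at z)"
          unfolding K_def u_def by (auto intro!: derivative_eq_intros simp del: power_Suc)
        moreover have "((\<lambda>z. (of_real t - \<i> * z) ^ b) has_field_derivative
            of_nat b * (- \<i> * v ^ (b - 1))) (at z)"
          unfolding v_def by (auto intro!: derivative_eq_intros)
        ultimately have "((\<lambda>z. (of_real t + \<i> * z) ^ Suc a * (of_real t - \<i> * z) ^ b / (\<i> * K))
            has_field_derivative (K * (\<i> * u ^ a) * v ^ b +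
              of_nat b * (- \<i> * v ^ (b - 1)) * u ^ Suc a) / (\<i> * K)) (at z)"
          unfolding u_def v_def by (intro DERIV_cdivide DERIV_mult)
        also have "(K * (\<i> * u ^ a) * v ^ b + of_nat b * (- \<i> * v ^ (b - 1)) * u ^ Suc a) / (\<i> * K) =
            u ^ a * v ^ b - of_nat b / K * (u ^ Suc a * v ^ (b - 1))"
          using \<open>K \<noteq> 0\<close> by (simp add: field_simps)
        finally show ?thesis unfolding K_def u_def v_def .
      qed
      then show "(?F has_vector_derivative Complex t s ^ a * cnj (Complex t s) ^ b -
       of_nat b / of_nat (a + 1) * (Complex t s ^ Suc a * cnj (Complex t s) ^ (b - 1)))
         (at s within {-w..w})"
        unfolding C(2) unfolding C(1) by (rule has_vector_derivative_real_field)
    qed (use w in simp)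
    \<comment> \<open>The ends of the chord lie on the unit circle, so powers there become
      \<open>cis\<close> of multiples of \<open>arccos t\<close>, and the difference is a
      sine.\<close>
    also have "?F w - ?F (- w) = of_real (2 / real (a + 1) * (w * poly (cheb_U (a - b)) t))"
    proof -
      define x where "x = real (a - b + 1) * arccos t"
      have x: "real (Suc a) * arccos t - real b * arccos t = x"
        using that by (simp add: x_def algebra_simps of_nat_diff)
      have "Complex t w ^ Suc a * cnj (Complex t w) ^ b = cis x"
        unfolding cis cis_cnj DeMoivre cis_mult x[symmetric] by (simp add: algebra_simps)
      moreover have "Complex t (-w) ^ Suc a * cnj (Complex t (-w)) ^ b = cis (-x)"
        unfolding cis cis_cnj DeMoivre cis_mult x[symmetric] by (simp add: algebra_simps)
      moreover have "w * poly (cheb_U (a - b)) t = sin x"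
        unfolding w_def x_def by (rule sqrt_cheb_U[OF assms(1)])
      moreover have "cis x - cis (- x) = 2 * \<i> * of_real (sin x)"
        by (simp add: complex_eq_iff)
      ultimately show ?thesis
        by (simp only: diff_divide_distrib[symmetric]) (simp add: divide_simps)
    qed
    finally show ?thesis .
  qed
  {
    case 0
    have "radon_poly a 0 t = 2 / real (a + 1) * poly (cheb_U a) t"
      by (simp add: radon_poly_def radon_coeff_def)
    with ftc[of 0 a] show ?case
      unfolding w_def by (simp add: ac_simps)
  next
    case (Suc b)
    have "((\<lambda>s. Complex t s ^ a * cnj (Complex t s) ^ Suc b) has_integral
        of_real (2 / real (a + 1) * (w * poly (cheb_U (a - Suc b)) t)) +
        of_nat (b + 1) / of_nat (a + 1) * of_real (w * radon_poly (Suc a) b t)) {-w..w}"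
      using has_integral_add[OF ftc[OF Suc.prems]
        has_integral_mult_right[OF Suc.IH[of "Suc a", folded w_def],
          of "of_nat (b + 1) / of_nat (a + 1)"]] Suc.prems
      by (simp del: of_nat_Suc power_Suc)
    also have "of_real (2 / real (a + 1) * (w * poly (cheb_U (a - Suc b)) t)) +
        of_nat (b + 1) / of_nat (a + 1) * of_real (w * radon_poly (Suc a) b t) =
        complex_of_real (w * radon_poly a (Suc b) t)"
      using Suc.prems by (subst radon_poly_rec) (auto simp: algebra_simps)
    finally show ?case unfolding w_def .
  }
qed

lemma has_integral_zz:
  assumes "\<bar>t\<bar> < 1"
  shows "((\<lambda>s. Complex t s ^ a * cnj (Complex t s) ^ b) has_integral
    of_real (sqrt (1 - t\<^sup>2) * radon_poly a b t)) {- sqrt (1 - t\<^sup>2) .. sqrt (1 - t\<^sup>2)}"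
proof (cases "b \<le> a")
  case True
  then show ?thesis by (rule has_integral_zz_aux[OF assms])
next
  case False
  then have "a \<le> b" by simp
  from has_integral_linear[OF has_integral_zz_aux[OF assms this] bounded_linear_cnj]
  show ?thesis by (simp add: o_def radon_poly_commute[of b a] ac_simps del: of_real_mult)
qed

lemma continuous_on_eval2_line:
  "continuous_on S (\<lambda>s. eval2 P (t * cos \<theta> - s * sin \<theta>, t * sin \<theta> + s * cos \<theta>))"
  unfolding eval2_altdef by (intro continuous_intros)

lemma radon_eval2_diff:
  "radon \<theta> (eval2 (P - Q)) t = radon \<theta> (eval2 P) t - radon \<theta> (eval2 Q) t"
proof -
  have "eval2 (P - Q) v = eval2 P v - eval2 Q v" for v
    by (cases v) (simp add: eval2_def)
  then show ?thesis
    unfolding radon_def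
    by (simp add: integral_diff integrable_continuous_real continuous_on_eval2_line)
qed

text \<open>The chord in direction \<open>\<theta>\<close> is the vertical chord rotated by
  \<open>cis \<theta>\<close>, so each monomial only picks up the character of frequency
  \<open>a - b\<close>.\<close>

lemma radon_eval2_eq:
  assumes "\<bar>t\<bar> < 1"
    and P: "\<And>z. of_real (eval2 P (Re z, Im z)) = (\<Sum>a\<le>n. \<Sum>b\<le>n. p a b * (z ^ a * cnj z ^ b))"
  shows "complex_of_real (radon \<theta> (eval2 P) t) = of_real (sqrt (1 - t\<^sup>2)) *
     (\<Sum>a\<le>n. \<Sum>b\<le>n. p a b * of_real (radon_poly a b t) * cis ((real a - real b) * \<theta>))"
proof -
  let ?I = "{- sqrt (1 - t\<^sup>2) .. sqrt (1 - t\<^sup>2)}"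
  let ?f = "\<lambda>s. eval2 P (t * cos \<theta> - s * sin \<theta>, t * sin \<theta> + s * cos \<theta>)"
  have "(?f has_integral radon \<theta> (eval2 P) t) ?I"
    unfolding radon_def
    by (intro integrable_integral integrable_continuous_real continuous_on_eval2_line)
  from has_integral_linear[OF this bounded_linear_of_real]
  have *: "((\<lambda>s. complex_of_real (?f s)) has_integral of_real (radon \<theta> (eval2 P) t)) ?I"
    by (simp add: o_def)
  have eq: "complex_of_real (?f s) = (\<Sum>a\<le>n. \<Sum>b\<le>n.
      p a b * cis ((real a - real b) * \<theta>) * (Complex t s ^ a * cnj (Complex t s) ^ b))" for s
  proof -
    let ?z = "cis \<theta> * Complex t s"
    have "?f s = eval2 P (Re ?z, Im ?z)"
      by (simp add: algebra_simps)
    moreover have "?z ^ a * cnj ?z ^ b = cis ((real a - real b) * \<theta>) * (Complex t s ^ a * cnj (Complex t s) ^ b)"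
      for a b
    proof -
      have "cis \<theta> ^ a * cnj (cis \<theta>) ^ b = cis ((real a - real b) * \<theta>)"
        unfolding cis_cnj DeMoivre cis_mult by (simp add: algebra_simps)
      then show ?thesis by (simp add: power_mult_distrib ac_simps)
    qed
    ultimately show ?thesis by (simp only: P mult.assoc)
  qed
  have "((\<lambda>s. complex_of_real (?f s)) has_integral (\<Sum>a\<le>n. \<Sum>b\<le>n.
      p a b * cis ((real a - real b) * \<theta>) * of_real (sqrt (1 - t\<^sup>2) * radon_poly a b t))) ?I"
    unfolding eq by (intro has_integral_sum has_integral_mult_right has_integral_zz assms(1)) auto
  from has_integral_unique[OF * this] show ?thesis
    by (simp add: sum_distrib_left ac_simps)
qed

subsection \<open>Aliasing\<close>

lemma sum_cis_multiples:
  fixes l :: int and N :: nat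
  assumes "0 < N"
  shows "(\<Sum>j<N. cis (of_int l * (2 * real j * pi / real N))) = (if int N dvd l then of_nat N else 0)"
proof -
  define w where "w = cis (2 * pi * of_int l / real N)"
  have pow: "cis (of_int l * (2 * real j * pi / real N)) = w ^ j" for j
    unfolding w_def DeMoivre by (simp add: field_simps)
  have w1: "w = 1 \<longleftrightarrow> int N dvd l"
  proof
    assume "w = 1"
    then have "cos (2 * pi * of_int l / real N) = 1" by (simp add: w_def complex_eq_iff)
    then obtain x :: int where "2 * pi * of_int l / real N = of_int x * 2 * pi"
      unfolding cos_one_2pi_int by blast
    then have "of_int l = (of_int (x * int N) :: real)" using assms by (simp add: field_simps)
    then show "int N dvd l" unfolding of_int_eq_iff by simp
  next
    assume "int N dvd l"
    then obtain x where "l = int N * x" ..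
    then have "2 * pi * of_int l / real N = 2 * pi * of_int x" using assms by simp
    then show "w = 1" unfolding w_def by (simp add: complex_eq_iff)
  qed
  have wN: "w ^ N = 1"
    unfolding w_def DeMoivre using assms by (simp add: complex_eq_iff)
  show ?thesis
    unfolding pow using w1 wN by (auto simp: geometric_sum)
qed

text \<open>Discrete Fourier inversion: pairing with the conjugate character of frequency
  \<open>d\<close> over all \<open>N\<close> directions retains exactly the frequencies congruent to
  \<open>d\<close> modulo \<open>N\<close>.\<close>

lemma aliasing_class_sum:
  fixes v :: "nat \<Rightarrow> nat \<Rightarrow> complex" and N :: nat
  assumes "0 < N"
    and "\<And>j. j < N \<Longrightarrow>
      (\<Sum>a\<le>n. \<Sum>b\<le>n. v a b * cis ((real a - real b) * (2 * real j * pi / real N))) = 0"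
  shows "(\<Sum>(a, b) | a \<le> n \<and> b \<le> n \<and> int N dvd int a - int b - d. v a b) = 0"
proof -
  define \<phi> where "\<phi> j = 2 * real j * pi / real N" for j
  have "0 = (\<Sum>j<N. cis (- of_int d * \<phi> j) * (\<Sum>a\<le>n. \<Sum>b\<le>n. v a b * cis ((real a - real b) * \<phi> j)))"
    using assms(2) unfolding \<phi>_def by (intro sum.neutral[symmetric]) simp
  also have "\<dots> = (\<Sum>j<N. \<Sum>a\<le>n. \<Sum>b\<le>n. v a b * cis (of_int (int a - int b - d) * \<phi> j))"
    unfolding sum_distrib_left
    by (intro sum.cong refl) (simp add: mult.left_commute cis_mult algebra_simps)
  also have "\<dots> = (\<Sum>a\<le>n. \<Sum>b\<le>n. v a b * (\<Sum>j<N. cis (of_int (int a - int b - d) * \<phi> j)))"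
    unfolding sum_distrib_left
    by (subst sum.swap, rule sum.cong[OF refl], rule sum.swap)
  also have "\<dots> = (\<Sum>a\<le>n. \<Sum>b\<le>n. if int N dvd int a - int b - d then of_nat N * v a b else 0)"
    unfolding \<phi>_def sum_cis_multiples[OF assms(1)] by (intro sum.cong refl) simp
  also have "\<dots> = (\<Sum>x\<in>{..n}\<times>{..n}. if int N dvd int (fst x) - int (snd x) - d
      then of_nat N * v (fst x) (snd x) else 0)"
    by (simp add: sum.cartesian_product case_prod_unfold)
  also have "\<dots> = (\<Sum>(a, b) | a \<le> n \<and> b \<le> n \<and> int N dvd int a - int b - d. of_nat N * v a b)"
    by (rule sum.mono_neutral_cong_right) auto
  finally show ?thesis
    using assms(1) by (simp add: case_prod_unfold sum_distrib_left[symmetric])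
qed

subsection \<open>Linear independence of Chebyshev polynomials on the nodes\<close>

text \<open>A condition on a set of degrees, so that the sets from \<open>X_degrees\<close> and the
  set of even degrees can be treated alike.\<close>

definition cheb_indep :: "nat \<Rightarrow> (nat \<Rightarrow> real) \<Rightarrow> nat set \<Rightarrow> bool" where
  "cheb_indep m t I \<longleftrightarrow> finite I \<and> (\<forall>c. (\<forall>k<m. (\<Sum>i\<in>I. c i * poly (cheb_U i) (t k)) = 0) \<longrightarrow>
     (\<forall>i\<in>I. c i = 0))"

lemma cheb_indep_complexD:
  fixes c :: "nat \<Rightarrow> complex"
  assumes "cheb_indep m t I" "\<And>k. k < m \<Longrightarrow> (\<Sum>i\<in>I. c i * of_real (poly (cheb_U i) (t k))) = 0"
    and "i \<in> I"
  shows "c i = 0"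
proof (rule complex_eqI)
  note I = assms(1)[unfolded cheb_indep_def, THEN conjunct2, THEN spec, THEN mp, THEN bspec, OF _ assms(3)]
  have "\<forall>k<m. (\<Sum>i\<in>I. Re (c i) * poly (cheb_U i) (t k)) = 0"
    using arg_cong[OF assms(2), where f = Re] by simp
  then show "Re (c i) = Re 0" unfolding zero_complex.sel by (rule I)
  have "\<forall>k<m. (\<Sum>i\<in>I. Im (c i) * poly (cheb_U i) (t k)) = 0"
    using arg_cong[OF assms(2), where f = Im] by simp
  then show "Im (c i) = Im 0" unfolding zero_complex.sel by (rule I)
qed

lemma set_X_degrees:
  assumes "1 \<le> j" "j \<le> m"
  shows "set (X_degrees m j) =
    {i. even i \<and> 2 * j \<le> i \<and> i < 2 * m} \<union> {i. odd i \<and> 2 * m - 2 * j < i \<and> i < 2 * m}"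
proof -
  have "i \<in> (\<lambda>i. 2 * m - 2 - 2 * i) ` {0..<m - j} \<longleftrightarrow> even i \<and> 2 * j \<le> i \<and> i < 2 * m" for i
  proof
    assume i: "even i \<and> 2 * j \<le> i \<and> i < 2 * m"
    then obtain q where "i = 2 * q" by (elim conjE evenE)
    with i assms show "i \<in> (\<lambda>i. 2 * m - 2 - 2 * i) ` {0..<m - j}"
      by (intro image_eqI[of _ _ "m - 1 - q"]) auto
  qed (use assms in auto)
  moreover have "i \<in> (\<lambda>i. 2 * m - 1 - 2 * i) ` {0..<j} \<longleftrightarrow>
      odd i \<and> 2 * m - 2 * j < i \<and> i < 2 * m" for i
  proof
    assume i: "odd i \<and> 2 * m - 2 * j < i \<and> i < 2 * m"
    then obtain q where "i = 2 * q + 1" by (elim conjE oddE)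
    with i assms show "i \<in> (\<lambda>i. 2 * m - 1 - 2 * i) ` {0..<j}"
      by (intro image_eqI[of _ _ "m - 1 - q"]) auto
  qed (use assms in auto)
  ultimately show ?thesis unfolding X_degrees_def by auto
qed

lemma distinct_X_degrees:
  assumes "1 \<le> j" "j \<le> m"
  shows "distinct (X_degrees m j)"
proof -
  have "inj_on (\<lambda>i. 2 * m - 2 - 2 * i) {0..<m - j}" "inj_on (\<lambda>i. 2 * m - 1 - 2 * i) {0..<j}"
    using assms by (auto intro!: inj_onI)
  moreover have "2 * m - 2 - 2 * i \<noteq> 2 * m - 1 - 2 * i'" if "i' < j" for i i'
  proof -
    have "odd (2 * m - 1 - 2 * i')" "even (2 * m - 2 - 2 * i)" using that assms by auto
    then show ?thesis by metis
  qed
  ultimately show ?thesis unfolding X_degrees_def by (auto simp: distinct_map)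
qed

text \<open>Rows of the matrix belong to degrees and columns to nodes. A combination vanishing at
  all nodes is therefore a vector killed by the transpose, and the transposed inverse recovers it as
  zero.\<close>

lemma invertible_Xi_mat_imp_indep:
  assumes "1 \<le> j" "j \<le> m" "invertible_mat (Xi_mat m j t)"
  shows "cheb_indep m t (set (X_degrees m j))"
  unfolding cheb_indep_def
proof (intro conjI allI impI ballI)
  fix c :: "nat \<Rightarrow> real" and i
  assume c: "\<forall>k<m. (\<Sum>i\<in>set (X_degrees m j). c i * poly (cheb_U i) (t k)) = 0"
    and i: "i \<in> set (X_degrees m j)"
  let ?X = "Xi_mat m j t" and ?L = "X_degrees m j"
  have len: "length ?L = m" using assms(2) unfolding X_degrees_def by simp
  have X: "?X \<in> carrier_mat m m" by (rule Xi_mat_carrier)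
  from assms(3) obtain B where B: "inverts_mat ?X B" "inverts_mat B ?X"
    unfolding invertible_mat_def by blast
  have XB: "?X * B = 1\<^sub>m m" using B(1) X unfolding inverts_mat_def by simp
  \<comment> \<open>The dimensions of \<open>B\<close> are not given; they are read off from the two
    products being identity matrices.\<close>
  have "dim_col B = m" using arg_cong[OF XB, of dim_col] by simp
  moreover have "dim_row B = m" using arg_cong[OF B(2)[unfolded inverts_mat_def], of dim_col] X by simp
  ultimately have Bc: "B \<in> carrier_mat m m" by auto
  define v where "v = vec_of_list (map c ?L)"
  have v: "v \<in> carrier_vec m" unfolding v_def by (intro carrier_vecI) (simp only: dim_vec_of_list length_map len)
  have "transpose_mat ?X *\<^sub>v v = 0\<^sub>v m"
  proof (rule eq_vecI)
    fix k assume "k < dim_vec (0\<^sub>v m :: real vec)"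
    then have k: "k < m" by simp
    have "(transpose_mat ?X *\<^sub>v v) $ k = X_vec m j (t k) \<bullet> v"
      using k X by (simp add: Xi_mat_col[OF assms(2) k])
    also have "\<dots> = (\<Sum>q<m. c (?L ! q) * poly (cheb_U (?L ! q)) (t k))"
      unfolding scalar_prod_def v_def X_vec_def
      by (simp add: len vec_of_list_index atLeast0LessThan mult.commute)
    also have "\<dots> = (\<Sum>i\<in>set ?L. c i * poly (cheb_U i) (t k))"
      using sum.reindex_bij_betw[OF bij_betw_nth[OF distinct_X_degrees[OF assms(1,2)] refl refl],
        of "\<lambda>i. c i * poly (cheb_U i) (t k)"] len by simp
    finally show "(transpose_mat ?X *\<^sub>v v) $ k = 0\<^sub>v m $ k" using c k by simp
  qed (use X in simp)
  then have "transpose_mat B *\<^sub>v (transpose_mat ?X *\<^sub>v v) = 0\<^sub>v m"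
    using Bc by (auto intro!: eq_vecI)
  moreover have "transpose_mat B *\<^sub>v (transpose_mat ?X *\<^sub>v v) = (transpose_mat B * transpose_mat ?X) *\<^sub>v v"
    using Bc X v by (intro assoc_mult_mat_vec[symmetric]) auto
  moreover have "transpose_mat B * transpose_mat ?X = 1\<^sub>m m"
    using transpose_mult[OF X Bc] XB by simp
  ultimately have v0: "v = 0\<^sub>v m" using v by simp
  from i obtain q where q: "q < m" "i = ?L ! q" unfolding in_set_conv_nth len by blast
  have "c i = v $ q" unfolding v_def using q len by (simp add: vec_of_list_index)
  then show "c i = 0" using v0 q by simp
qed simp

text \<open>Induction along the recurrence expressing \<open>cheb_U (l + 2)\<close> as
  \<open>2 x\<close> times \<open>cheb_U (l + 1)\<close> minus \<open>cheb_U l\<close>; the first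
  summand has the larger degree.\<close>

lemma degree_cheb_U: "degree (cheb_U k) = k"
proof (induction k rule: less_induct)
  case (less k)
  consider "k = 0" | "k = 1" | l where "k = Suc (Suc l)"
    by (metis One_nat_def not0_implies_Suc)
  then show ?case
  proof cases
    case 1
    have "1 = cheb_U 0" by (rule cheb_U_unique) simp
    then show ?thesis using 1 by (metis degree_1)
  next
    case 2
    have "[:0, 2:] = cheb_U 1" by (rule cheb_U_unique) (simp add: sin_double)
    then have "degree (cheb_U 1) = degree [:0, 2 :: real:]" by simp
    then show ?thesis using 2 by simp
  next
    case (3 l)
    have "[:0, 2:] * cheb_U (Suc l) - cheb_U l = cheb_U k"
    proof (rule cheb_U_unique)
      fix \<theta> :: real assume s: "sin \<theta> \<noteq> 0"
      define a where "a = real (Suc l + 1) * \<theta>"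
      have e: "real (k + 1) * \<theta> = a + \<theta>" "real (l + 1) * \<theta> = a - \<theta>"
        by (simp_all add: a_def 3 algebra_simps)
      show "poly ([:0, 2:] * cheb_U (Suc l) - cheb_U l) (cos \<theta>) = sin (real (k + 1) * \<theta>) / sin \<theta>"
        using s unfolding poly_diff poly_mult cheb_U_cos[OF s] e a_def[symmetric]
        by (simp add: field_simps sin_add sin_diff)
    qed
    moreover have d: "degree (cheb_U (Suc l)) = Suc l" "degree (cheb_U l) = l"
      using less.IH 3 by auto
    moreover have "degree ([:0, 2:] * cheb_U (Suc l)) = Suc (Suc l)"
    proof (subst degree_mult_eq)
      show "cheb_U (Suc l) \<noteq> 0" using d(1) by auto
    qed (auto simp: d)
    moreover have "degree (- cheb_U l) < degree ([:0, 2:] * cheb_U (Suc l))"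
      using calculation by simp
    ultimately show ?thesis
      using degree_add_eq_left[of "- cheb_U l" "[:0, 2:] * cheb_U (Suc l)"] 3 by simp
  qed
qed

lemma sum_cheb_U_eq_0:
  assumes "finite I" "(\<Sum>i\<in>I. Polynomial.smult (c i) (cheb_U i)) = 0"
  shows "\<forall>i\<in>I. c i = 0"
proof (rule ccontr)
  assume *: "\<not> (\<forall>i\<in>I. c i = 0)"
  define J where "J = {i \<in> I. c i \<noteq> 0}"
  have J: "finite J" "J \<noteq> {}" using assms(1) * by (auto simp: J_def)
  define M where "M = Max J"
  have M: "M \<in> J" using J by (simp add: M_def)
  have "coeff (\<Sum>i\<in>I. Polynomial.smult (c i) (cheb_U i)) M = (\<Sum>i\<in>I. c i * coeff (cheb_U i) M)"
    by (simp add: coeff_sum)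
  also have "\<dots> = (\<Sum>i\<in>{M}. c i * coeff (cheb_U i) M)"
  proof (rule sum.mono_neutral_right)
    show "\<forall>i\<in>I - {M}. c i * coeff (cheb_U i) M = 0"
    proof
      fix i assume i: "i \<in> I - {M}"
      show "c i * coeff (cheb_U i) M = 0"
      proof (cases "i \<in> J")
        case True
        then have "i < M" using i J by (auto simp: M_def order.strict_iff_order)
        then show ?thesis by (simp add: coeff_eq_0 degree_cheb_U)
      qed (use i in \<open>auto simp: J_def\<close>)
    qed
  qed (use assms M in \<open>auto simp: J_def\<close>)
  finally have "c M * lead_coeff (cheb_U M) = 0" using assms(2) by (simp add: degree_cheb_U)
  moreover have "cheb_U M \<noteq> 0"
  proof
    assume 0: "cheb_U M = 0"
    \<comment> \<open>At this angle the numerator is \<open>sin (pi / 2)\<close>. The degree alone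
      would not exclude the zero polynomial when \<open>M = 0\<close>.\<close>
    define \<theta> where "\<theta> = pi / (2 * real (M + 1))"
    have "0 < \<theta>" "\<theta> < pi" unfolding \<theta>_def by (simp_all add: field_simps add_pos_nonneg)
    then have s: "sin \<theta> \<noteq> 0" using sin_gt_zero[of \<theta>] by simp
    have "real (M + 1) * \<theta> = pi / 2" unfolding \<theta>_def by (simp add: field_simps)
    then have "poly (cheb_U M) (cos \<theta>) = 1 / sin \<theta>" by (simp only: cheb_U_cos[OF s] sin_pi_half)
    then show False using 0 s by simp
  qed
  ultimately show False using M by (auto simp: J_def)
qed

text \<open>An even combination vanishes at \<open>t k\<close> and at \<open>- t k\<close>. By
  asymmetry these are \<open>2 * m\<close> distinct roots, more than its degree allows.\<close>

lemma cheb_indep_even: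
  assumes "inj_on t {..<m}" "asymmetric (t ` {..<m})"
  shows "cheb_indep m t {i. even i \<and> i < 2 * m}"
  unfolding cheb_indep_def
proof (intro conjI allI impI)
  let ?I = "{i. even i \<and> i < 2 * m}"
  fix c :: "nat \<Rightarrow> real"
  assume c: "\<forall>k<m. (\<Sum>i\<in>?I. c i * poly (cheb_U i) (t k)) = 0"
  have T: "t ` {..<m} \<subseteq> {-1<..<0} \<union> {0<..<1}" "\<And>x. \<not> (x \<in> t ` {..<m} \<and> - x \<in> t ` {..<m})"
    using assms(2) unfolding asymmetric_def by auto
  define R where "R = (\<Sum>i\<in>?I. Polynomial.smult (c i) (cheb_U i))"
  have R: "poly R x = (\<Sum>i\<in>?I. c i * poly (cheb_U i) x)" for x
    unfolding R_def by (simp add: poly_sum)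
  have "R = 0"
  proof (rule ccontr)
    assume "R \<noteq> 0"
    let ?A = "t ` {..<m} \<union> uminus ` t ` {..<m}"
    have "?A \<subseteq> {x. poly R x = 0}"
    proof -
      have "poly R (t k) = 0 \<and> poly R (- t k) = 0" if "k < m" for k
      proof -
        have "\<bar>t k\<bar> < 1" using T(1) that by auto
        then show ?thesis using c that by (simp add: R cheb_U_uminus_even)
      qed
      then show ?thesis by auto
    qed
    then have "card ?A \<le> card {x. poly R x = 0}"
      using poly_roots_finite[OF \<open>R \<noteq> 0\<close>] by (intro card_mono)
    also have "\<dots> \<le> degree R" by (rule card_poly_roots_bound[OF \<open>R \<noteq> 0\<close>])
    also have "degree R \<le> 2 * m - 1"
      unfolding R_def by (rule degree_sum_le) (auto simp: degree_cheb_U intro: order.trans[OF degree_smult_le])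
    also have "card ?A = 2 * m"
    proof (subst card_Un_disjoint)
      have "- x \<in> t ` {..<m}" if "x \<in> uminus ` t ` {..<m}" for x using that by auto
      then show "t ` {..<m} \<inter> uminus ` t ` {..<m} = {}" using T(2) by blast
    qed (use assms(1) in \<open>auto simp: card_image\<close>)
    \<comment> \<open>Because of truncated subtraction the bound leaves the case
      \<open>m = 0\<close>, in which \<open>R\<close> is an empty sum.\<close>
    finally have "m = 0" by simp
    then show False using \<open>R \<noteq> 0\<close> unfolding R_def by simp
  qed
  then show "\<forall>i\<in>?I. c i = 0" unfolding R_def by (intro sum_cheb_U_eq_0) auto
qed simp

section \<open>Degrees within one residue class of frequencies\<close>

text \<open>Two pairs of equal degree have frequencies differing by \<open>2 * (a - a')\<close>; as
  the modulus is odd and exceeds the absolute value of \<open>a - a'\<close>, they agree. A degree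
  has the parity of its frequency and is at least its absolute value. With \<open>2 * j\<close> and
  \<open>2 * m + 1 - 2 * j\<close> as absolute values of the even and the odd frequency, these are
  the lower bounds in \<open>set_X_degrees\<close>.\<close>

lemma aliasing_class_degrees:
  fixes d :: int and m :: nat
  assumes "\<bar>d\<bar> < 2 * int m"
  defines "S \<equiv> {(a, b). a + b < 2 * m \<and> int (2 * m + 1) dvd int a - int b - d}"
  shows "inj_on (\<lambda>(a, b). a + b) S"
    and "(\<lambda>(a, b). a + b) ` S \<subseteq> {i. even i \<and> i < 2 * m} \<or>
      (\<exists>j. 1 \<le> j \<and> j \<le> m \<and> (\<lambda>(a, b). a + b) ` S \<subseteq> set (X_degrees m j))"
proof -
  show "inj_on (\<lambda>(a, b). a + b) S"
  proof (rule inj_onI, clarify)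
    fix a b a' b' assume h: "(a, b) \<in> S" "(a', b') \<in> S" "a + b = a' + b'"
    have "int (2 * m + 1) dvd (int a - int b - d) - (int a' - int b' - d)"
      using h unfolding S_def by (simp only: mem_Collect_eq prod.case dvd_diff)
    also have "(int a - int b - d) - (int a' - int b' - d) = 2 * (int a - int a')" using h(3) by simp
    finally have "int (2 * m + 1) dvd int a - int a'"
      by (subst (asm) coprime_dvd_mult_right_iff) auto
    moreover have "\<bar>int a - int a'\<bar> < int (2 * m + 1)" using h unfolding S_def by auto
    ultimately have "int a = int a'" by (metis dvd_imp_le_int eq_iff_diff_eq_0 abs_of_nat linorder_not_le)
    then show "a = a' \<and> b = b'" using h(3) by simp
  qed
next
  define N where "N = 2 * int m + 1"
  have diff: "int a - int b = d \<or> int a - int b = d - N \<or> int a - int b = d + N"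
    "\<bar>int a - int b\<bar> \<le> int (a + b)" "a + b < 2 * m" "even (int a - int b) = even (a + b)"
    if ab: "(a, b) \<in> S" for a b
  proof -
    show ab': "a + b < 2 * m" "\<bar>int a - int b\<bar> \<le> int (a + b)" "even (int a - int b) = even (a + b)"
      using ab by (auto simp: S_def)
    have "N dvd int a - int b - d" using ab by (simp add: S_def N_def add.commute)
    then obtain q where q: "int a - int b - d = N * q" by (rule dvdE)
    have "\<bar>int a - int b - d\<bar> \<le> \<bar>int a - int b\<bar> + \<bar>d\<bar>" by (rule abs_triangle_ineq4)
    also have "\<dots> < 2 * int m + 2 * int m"
      using ab'(1,2) assms(1) by (intro add_strict_mono) simp_all
    also have "\<dots> < N * 2" by (simp add: N_def)
    finally have "\<bar>int a - int b - d\<bar> < N * 2" .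
    then have "\<bar>N * q\<bar> < N * 2" unfolding q .
    then have "N * \<bar>q\<bar> < N * 2" by (simp add: abs_mult N_def)
    then have "\<bar>q\<bar> < 2" by (rule mult_left_less_imp_less) (simp add: N_def)
    then have "q = -1 \<or> q = 0 \<or> q = 1" by auto
    then show "int a - int b = d \<or> int a - int b = d - N \<or> int a - int b = d + N" using q by auto
  qed
  show "(\<lambda>(a, b). a + b) ` S \<subseteq> {i. even i \<and> i < 2 * m} \<or>
      (\<exists>j. 1 \<le> j \<and> j \<le> m \<and> (\<lambda>(a, b). a + b) ` S \<subseteq> set (X_degrees m j))"
  proof (cases "d = 0")
    case True
    \<comment> \<open>The other candidates, plus and minus \<open>N\<close>, are too large in
      absolute value, so the frequency is zero.\<close>
    have "even (a + b) \<and> a + b < 2 * m" if ab: "(a, b) \<in> S" for a b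
      using diff[OF ab] True unfolding N_def by auto
    then show ?thesis by auto
  next
    case False
    \<comment> \<open>Up to sign, \<open>2 * j\<close> is the even frequency of the class:
      \<open>d\<close> itself, or \<open>d\<close> shifted by \<open>N\<close> towards zero and
      beyond when \<open>d\<close> is odd.\<close>
    obtain j :: nat where j: "1 \<le> j" "j \<le> m"
      "d = 2 * int j \<or> d = - 2 * int j \<or> d = 2 * int j - N \<or> d = N - 2 * int j"
    proof (cases "even d")
      case True
      then obtain q where "d = 2 * q" by (rule evenE)
      then show ?thesis using False assms(1) by (intro that[of "nat \<bar>q\<bar>"]) auto
    next
      case odd: False
      then obtain q where q: "d = 2 * q + 1" by (rule oddE)
      show ?thesis
      proof (cases "0 \<le> q")
        case True
        then show ?thesis using q assms(1) by (intro that[of "nat (int m - q)"]) (auto simp: N_def)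
      next
        case neg: False
        then show ?thesis using q assms(1) by (intro that[of "nat (int m + q + 1)"]) (auto simp: N_def)
      qed
    qed
    have "a + b \<in> set (X_degrees m j)" if ab: "(a, b) \<in> S" for a b
    proof -
      define u where "u = int a - int b"
      have "\<bar>u\<bar> < 2 * int m" using diff(2,3)[OF ab] unfolding u_def by linarith
      with diff(1)[OF ab, folded u_def] j
      have "u \<in> {2 * int j, - 2 * int j} \<or> u \<in> {2 * int j - N, N - 2 * int j}"
        unfolding N_def by (elim disjE) auto
      then show ?thesis
      proof
        assume "u \<in> {2 * int j, - 2 * int j}"
        then have "even u" "2 * int j \<le> int (a + b)" using diff(2)[OF ab, folded u_def] by auto
        then have "even (a + b)" "2 * j \<le> a + b"
          using diff(4)[OF ab, folded u_def] by (blast, linarith)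
        then show ?thesis using diff(3)[OF ab] unfolding set_X_degrees[OF j(1,2)] by auto
      next
        assume "u \<in> {2 * int j - N, N - 2 * int j}"
        then have "odd u" "2 * int m - 2 * int j < int (a + b)"
          using diff(2)[OF ab, folded u_def] j(2) by (auto simp: N_def)
        then have "odd (a + b)" "2 * m - 2 * j < a + b"
          using diff(4)[OF ab, folded u_def] j(2) by (blast, linarith)
        then show ?thesis using diff(3)[OF ab] unfolding set_X_degrees[OF j(1,2)] by auto
      qed
    qed
    then show ?thesis using j by auto
  qed
qed

text \<open>Pushing \<open>c\<close> forward along the degree map gives coefficients on
  \<open>I\<close>, extended by zero off the image. Injectivity makes each nonempty fibre a single
  pair, so nothing can cancel.\<close>

lemma cheb_indep_class:
  fixes c :: "nat \<times> nat \<Rightarrow> complex"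
  assumes "cheb_indep m t I" "inj_on (\<lambda>(a, b). a + b) S" "(\<lambda>(a, b). a + b) ` S \<subseteq> I"
    and "\<And>k. k < m \<Longrightarrow> (\<Sum>x\<in>S. c x * of_real (poly (cheb_U (fst x + snd x)) (t k))) = 0"
    and "x \<in> S"
  shows "c x = 0"
proof -
  let ?g = "\<lambda>(a, b). a + b :: nat"
  have I: "finite I" using assms(1) by (simp add: cheb_indep_def)
  have S: "finite S" using finite_subset[OF assms(3) I] assms(2) by (rule finite_imageD)
  define c' where "c' i = (\<Sum>x | x \<in> S \<and> ?g x = i. c x)" for i
  have sum0: "(\<Sum>i\<in>I. c' i * of_real (poly (cheb_U i) (t k))) = 0" if "k < m" for k
  proof -
    have "(\<Sum>i\<in>I. c' i * of_real (poly (cheb_U i) (t k))) =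
        (\<Sum>i\<in>I. \<Sum>x | x \<in> S \<and> ?g x = i. c x * of_real (poly (cheb_U (?g x)) (t k)))"
      unfolding c'_def sum_distrib_right by (intro sum.cong) auto
    also have "\<dots> = (\<Sum>x\<in>S. c x * of_real (poly (cheb_U (?g x)) (t k)))"
      by (rule sum.group[OF S I assms(3)])
    also have "\<dots> = 0" using assms(4)[OF that] by (simp add: case_prod_unfold)
    finally show ?thesis .
  qed
  have "?g x \<in> I" using assms(3,5) by (rule subsetD[OF _ imageI])
  with sum0 have "c' (?g x) = 0" by (rule cheb_indep_complexD[OF assms(1)])
  moreover have "{y. y \<in> S \<and> ?g y = ?g x} = {x}"
    using inj_onD[OF assms(2)] assms(5) by blast
  ultimately show ?thesis unfolding c'_def by simp
qed

section \<open>Regrouping by Chebyshev degree and triangularity\<close>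

text \<open>Subtracting \<open>r\<close> from both exponents preserves the frequency, hence the
  class, and turns the index \<open>a + b - 2 * r\<close> into the new total degree.\<close>

lemma sum_radon_poly_class:
  fixes p :: "nat \<Rightarrow> nat \<Rightarrow> complex" and d :: int and N n :: nat
  defines "S \<equiv> {(a, b). a \<le> n \<and> b \<le> n \<and> int N dvd int a - int b - d}"
  assumes "\<And>a b. n < a + b \<Longrightarrow> p a b = 0"
  shows "(\<Sum>(a, b)\<in>S. p a b * of_real (radon_poly a b x)) =
    (\<Sum>(a, b)\<in>S. (\<Sum>r\<le>n. p (a + r) (b + r) * of_real (radon_coeff (a + r) (b + r) r)) *
       of_real (poly (cheb_U (a + b)) x))"
proof -
  have fin: "finite S" by (rule finite_subset[of _ "{..n} \<times> {..n}"]) (auto simp: S_def)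
  let ?U = "\<lambda>i. complex_of_real (poly (cheb_U i) x)"
  have "(\<Sum>(a, b)\<in>S. p a b * of_real (radon_poly a b x)) =
      (\<Sum>(a, b)\<in>S. \<Sum>r\<le>min a b. p a b * of_real (radon_coeff a b r) * ?U (a + b - 2 * r))"
    unfolding radon_poly_def by (intro sum.cong refl) (simp add: case_prod_unfold sum_distrib_left mult.assoc)
  also have "\<dots> = (\<Sum>((a, b), r)\<in>(SIGMA y:S. {..min (fst y) (snd y)}).
      p a b * of_real (radon_coeff a b r) * ?U (a + b - 2 * r))"
    using fin by (simp add: sum.Sigma case_prod_unfold)
  also have "\<dots> = (\<Sum>((a, b), r)\<in>S \<times> {..n}.
      p (a + r) (b + r) * of_real (radon_coeff (a + r) (b + r) r) * ?U (a + b))"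
  \<comment> \<open>The exceptional set \<open>T'\<close> holds the shifts that leave the square of
    exponents; there \<open>p\<close> vanishes by its support.\<close>
  proof (rule sum.reindex_bij_witness_not_neutral[where
      i = "\<lambda>((a, b), r). ((a + r, b + r), r)" and j = "\<lambda>((a, b), r). ((a - r, b - r), r)" and
      S' = "{}" and T' = "{((a, b), r). (a, b) \<in> S \<and> r \<le> n \<and> (n < a + r \<or> n < b + r)}"])
    show "finite {((a, b), r). (a, b) \<in> S \<and> r \<le> n \<and> (n < a + r \<or> n < b + r)}"
      by (rule finite_subset[of _ "S \<times> {..n}"]) (use fin in auto)
  qed (auto simp: S_def assms(2) of_nat_diff mult_2)
  also have "\<dots> = (\<Sum>(a, b)\<in>S. (\<Sum>r\<le>n. p (a + r) (b + r) * of_real (radon_coeff (a + r) (b + r) r)) * ?U (a + b))"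
    using fin by (simp add: sum.cartesian_product case_prod_unfold sum_distrib_right)
  finally show ?thesis .
qed

text \<open>Descending induction on the total degree: every term with \<open>r > 0\<close> involves
  a coefficient of higher degree, and the term \<open>r = 0\<close> has a nonzero factor.\<close>

lemma coeffs_eq_0_if_triangular:
  fixes p :: "nat \<Rightarrow> nat \<Rightarrow> complex"
  assumes supp: "\<And>a b. n < a + b \<Longrightarrow> p a b = 0"
    and c: "\<And>a b. a + b \<le> n \<Longrightarrow>
      (\<Sum>r\<le>n. p (a + r) (b + r) * of_real (radon_coeff (a + r) (b + r) r)) = 0"
  shows "p a b = 0"
proof (induction "n - (a + b)" arbitrary: a b rule: less_induct)
  case less
  show ?case
  proof (cases "n < a + b")
    case False
    have "p (a + r) (b + r) = 0" if "0 < r" for r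
      \<comment> \<open>For \<open>a + b = n\<close> the measure cannot decrease, and the support
        condition takes over.\<close>
      using less[of "a + r" "b + r"] supp[of "a + r" "b + r"] that False by (cases "a + b = n") auto
    then have "(\<Sum>r\<le>n. p (a + r) (b + r) * of_real (radon_coeff (a + r) (b + r) r)) =
        (\<Sum>r\<in>{0}. p (a + r) (b + r) * of_real (radon_coeff (a + r) (b + r) r))"
      by (intro sum.mono_neutral_right) auto
    moreover have "radon_coeff a b 0 \<noteq> 0" by (simp add: radon_coeff_def del: fact_Suc)
    ultimately show ?thesis using c[of a b] False by simp
  qed (rule supp)
qed

theorem theorem2p7:
  fixes m :: nat and t :: "nat \<Rightarrow> real"
  assumes "m \<ge> 1"
    and "inj_on t {..<m}"
    and "asymmetric (t ` {..<m})"
    and "\<And>j. 1 \<le> j \<Longrightarrow> j \<le> m \<Longrightarrow> invertible_mat (Xi_mat m j t)"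
  shows "\<forall>P \<in> Pi2 (2 * m - 1). \<forall>Q \<in> Pi2 (2 * m - 1).
           (\<forall>j \<le> 2 * m. \<forall>k < m.
              radon (2 * real j * pi / (2 * real m + 1)) (eval2 P) (t k) =
              radon (2 * real j * pi / (2 * real m + 1)) (eval2 Q) (t k))
           \<longrightarrow> P = Q"
proof (intro ballI impI)
  fix P Q
  assume PQ: "P \<in> Pi2 (2 * m - 1)" "Q \<in> Pi2 (2 * m - 1)"
    and eq: "\<forall>j \<le> 2 * m. \<forall>k < m.
              radon (2 * real j * pi / (2 * real m + 1)) (eval2 P) (t k) =
              radon (2 * real j * pi / (2 * real m + 1)) (eval2 Q) (t k)"
  define n N where "n = 2 * m - 1" and "N = 2 * m + 1"
  have "P - Q \<in> Pi2 n"
    unfolding Pi2_def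
  proof (intro CollectI allI impI)
    fix i j assume "coeff (coeff (P - Q) j) i \<noteq> 0"
    then have "coeff (coeff P j) i \<noteq> 0 \<or> coeff (coeff Q j) i \<noteq> 0" by auto
    then show "i + j \<le> n" using PQ unfolding Pi2_def n_def by blast
  qed
  from zz_poly_eval2[OF this] obtain p where
    supp: "\<And>a b. n < a + b \<Longrightarrow> p a b = 0" and
    p: "\<And>z. of_real (eval2 (P - Q) (Re z, Im z)) = (\<Sum>a\<le>n. \<Sum>b\<le>n. p a b * (z ^ a * cnj z ^ b))"
    unfolding zz_poly_def by blast
  \<comment> \<open>The total contribution of the monomials of frequency \<open>a - b\<close> to the
    Chebyshev polynomial of degree \<open>a + b\<close>.\<close>
  define c where
    "c a b = (\<Sum>r\<le>n. p (a + r) (b + r) * of_real (radon_coeff (a + r) (b + r) r))" for a b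
  have csupp: "c a b = 0" if "n < a + b" for a b
    unfolding c_def using that by (intro sum.neutral) (simp add: supp)
  have "c a b = 0" if ab: "a + b \<le> n" for a b
  proof -
    define d where "d = int a - int b"
    define S where "S = {(a, b). a + b < 2 * m \<and> int N dvd int a - int b - d}"
    let ?S' = "{(a, b). a \<le> n \<and> b \<le> n \<and> int N dvd int a - int b - d}"
    have d: "\<bar>d\<bar> < 2 * int m" using ab assms(1) unfolding d_def n_def by auto
    have sum0: "(\<Sum>x\<in>S. case_prod c x * of_real (poly (cheb_U (fst x + snd x)) (t k))) = 0"
      if k: "k < m" for k
    proof -
      have t: "\<bar>t k\<bar> < 1" using assms(3) k unfolding asymmetric_def by auto
      have "1 - (t k)\<^sup>2 \<noteq> 0" using t by (auto simp: power2_eq_1_iff)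
      then have sq: "complex_of_real (sqrt (1 - (t k)\<^sup>2)) \<noteq> 0" by simp
      have "(\<Sum>(a, b)\<in>?S'. p a b * of_real (radon_poly a b (t k))) = 0"
      proof (rule aliasing_class_sum)
        fix j assume "j < N"
        then have "radon (2 * real j * pi / real N) (eval2 (P - Q)) (t k) = 0"
          using eq k unfolding radon_eval2_diff N_def by (simp add: add.commute)
        from radon_eval2_eq[OF t p, of "2 * real j * pi / real N", unfolded this] sq
        show "(\<Sum>a\<le>n. \<Sum>b\<le>n. p a b * of_real (radon_poly a b (t k)) *
          cis ((real a - real b) * (2 * real j * pi / real N))) = 0" by simp
      qed (simp add: N_def)
      then have "0 = (\<Sum>(a, b)\<in>?S'. c a b * of_real (poly (cheb_U (a + b)) (t k)))"
        unfolding c_def by (subst (asm) sum_radon_poly_class[OF supp]) simp_all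
      \<comment> \<open>The square is cut down to total degree below \<open>2 * m\<close>, where the
        degree map is injective on the class; outside, \<open>c\<close> is zero.\<close>
      also have "\<dots> = (\<Sum>(a, b)\<in>S. c a b * of_real (poly (cheb_U (a + b)) (t k)))"
      proof (rule sum.mono_neutral_right)
        show "finite ?S'" by (rule finite_subset[of _ "{..n} \<times> {..n}"]) auto
        show "S \<subseteq> ?S'" by (auto simp: S_def n_def)
        show "\<forall>x\<in>?S' - S. (case x of (a, b) \<Rightarrow> c a b * of_real (poly (cheb_U (a + b)) (t k))) = 0"
          using assms(1) by (auto simp: S_def n_def intro!: csupp)
      qed
      finally show ?thesis by (simp add: case_prod_unfold)
    qed
    have inj: "inj_on (\<lambda>(a, b). a + b) S"
      unfolding S_def N_def by (rule aliasing_class_degrees(1)[OF d])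
    have deg: "(\<lambda>(a, b). a + b) ` S \<subseteq> {i. even i \<and> i < 2 * m} \<or>
        (\<exists>j. 1 \<le> j \<and> j \<le> m \<and> (\<lambda>(a, b). a + b) ` S \<subseteq> set (X_degrees m j))"
      unfolding S_def N_def by (rule aliasing_class_degrees(2)[OF d])
    obtain I where I: "cheb_indep m t I" "(\<lambda>(a, b). a + b) ` S \<subseteq> I"
      using deg
    proof (elim disjE exE conjE)
      fix j assume j: "1 \<le> j" "j \<le> m" "(\<lambda>(a, b). a + b) ` S \<subseteq> set (X_degrees m j)"
      show thesis by (rule that[OF invertible_Xi_mat_imp_indep[OF j(1,2) assms(4)[OF j(1,2)]] j(3)])
    qed (rule that[OF cheb_indep_even[OF assms(2,3)]])
    have "(a, b) \<in> S" using ab assms(1) by (auto simp: S_def d_def n_def)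
    from cheb_indep_class[OF I(1) inj I(2) sum0 this] show ?thesis by simp
  qed
  then have p0: "p a b = 0" for a b
    by (intro coeffs_eq_0_if_triangular[OF supp]) (simp_all add: c_def)
  have "eval2 (P - Q) (x, y) = 0" for x y
    using p[of "Complex x y"] by (simp add: p0)
  then have "P - Q = 0" by (rule eval2_eq_0_imp)
  then show "P = Q" by simp
qed

end
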